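(* Let $q$ be a prime power, $\alpha\ge 2$ an integer and $\varepsilon>0$, all fixed. For each $n$ let $W=W_n$ be the noise distribution of an additive noise channel on $\mathbb{F}_q^n$ (so $W(\mathbf{y}|\mathbf{x})=W(\mathbf{y}-\mathbf{x})$), let $N\sim W$, and let $1\le k=k_n\le n$ be such that the rate $R=k/n$ satisfies $$R\ \ge\ 1-\frac{H_\alpha(W)}{n}+\varepsilon .$$ Then $$\mathbb{E}_{F\sim\mathcal{B}}\,D_\alpha\big(U_F+N\,\big\|\,U_{\mathbb{F}_q^n}\big)\longrightarrow 0\qquad\text{as } n\to\infty .$$ More specifically, as $n\to\infty$, $$\mathbb{E}_{F\sim\mathcal{B}}\,q^{(\alpha-1)D_\alpha(U_F+N\|U_{\mathbb{F}_q^n})}\ \le\ 1+O(q^{-\varepsilon n}) .$$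
   Context: Additive noise channel on $\mathbb{F}_q^n$: $W$ is a probability mass function on $\mathbb{F}_q^n$ and the channel outputs $\mathbf{y}$ on input $\mathbf{x}$ with probability $W(\mathbf{y}|\mathbf{x})=W(\mathbf{y}-\mathbf{x})$; $N$ is a random vector with distribution $W$, independent of the channel input. All logarithms are to base $q$. For $\alpha>0$, $\alpha\ne1$: the Rényi entropy is $H_\alpha(W)=\frac{1}{1-\alpha}\log\sum_{\mathbf{x}\in\mathbb{F}_q^n}W(\mathbf{x})^\alpha$, and the Rényi divergence of probability mass functions $P,Q$ on a finite set is $D_\alpha(P\|Q)=\frac{1}{\alpha-1}\log\sum_x P(x)^\alpha Q(x)^{1-\alpha}$ (random variables stand for their distributions). $\mathcal{B}$ is the set of all $[n,k]$ linear codes, i.e. $k$-dimensional subspaces of $\mathbb{F}_q^n$ (each represented by an injective linear encoder $F:\mathbb{F}_q^k\to\mathbb{F}_q^n$ whose image is the code), and $F\sim\mathcal{B}$ means that the code is chosen uniformly at random. $U_F$ is uniform over the codewords of $F$ and independent of $N$; $U_{\mathbb{F}_q^n}$ is uniform over $\mathbb{F}_q^n$. The constant implied by $O(\cdot)$ does not depend on $n$. *)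

theory Defs
  imports
    "HOL-Probability.Probability"
    "HOL-Library.Landau_Symbols"
    "Jordan_Normal_Form.VS_Connect"
begin

text \<open>
  In both definitions \<open>S\<close> is a finite set that contains the supports of all distributions
  involved and \<open>b\<close> is the base of the logarithm.  As \<open>0 powr a = 0\<close> for every \<open>a\<close>, terms
  with \<open>P(x) = 0\<close> vanish.  The divergence is real-valued; for \<open>\<alpha> > 1\<close> it has the intended
  meaning only if \<open>Q\<close> is positive wherever \<open>P\<close> is (a uniform \<open>Q\<close> on \<open>S\<close> is).
\<close>

definition renyi_entropy :: "real \<Rightarrow> real \<Rightarrow> 'b set \<Rightarrow> 'b pmf \<Rightarrow> real" where
  "renyi_entropy b \<alpha> S W = 1 / (1 - \<alpha>) * log b (\<Sum>x\<in>S. pmf W x powr \<alpha>)"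

definition renyi_divergence :: "real \<Rightarrow> real \<Rightarrow> 'b set \<Rightarrow> 'b pmf \<Rightarrow> 'b pmf \<Rightarrow> real" where
  "renyi_divergence b \<alpha> S P Q =
     1 / (\<alpha> - 1) * log b (\<Sum>x\<in>S. pmf P x powr \<alpha> * pmf Q x powr (1 - \<alpha>))"

text \<open>
  An \<open>[n,k]\<close> code is identified with the \<open>k\<close>-dimensional subspace of codewords, since the
  encoder is only used through its image.  The dimension of a subspace is the dimension of the
  vector space obtained by restricting the carrier.
\<close>

definition linear_codes :: "nat \<Rightarrow> nat \<Rightarrow> 'a::{field,finite} vec set set" where
  "linear_codes n k =
     {C. VectorSpace.subspace class_ring C (module_vec TYPE('a) n) \<and>
         vectorspace.dim class_ring (module_vec TYPE('a) n \<lparr>carrier := C\<rparr>) = k}"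

text \<open>The distribution of \<open>X + N\<close> for independent \<open>X \<sim> P\<close> and \<open>N \<sim> W\<close>.\<close>

definition indep_sum_pmf :: "'a::plus vec pmf \<Rightarrow> 'a vec pmf \<Rightarrow> 'a vec pmf" where
  "indep_sum_pmf P W = map_pmf (\<lambda>(x, z). x + z) (pair_pmf P W)"

text \<open>\<open>D\<^sub>\<alpha>(U\<^sub>C + N \<parallel> U)\<close> on \<open>carrier_vec n\<close>, with logarithms to the base \<open>q\<close>.\<close>

definition smoothing_divergence ::
  "real \<Rightarrow> nat \<Rightarrow> 'a::{field,finite} vec pmf \<Rightarrow> 'a vec set \<Rightarrow> real" where
  "smoothing_divergence \<alpha> n W C =
     renyi_divergence (real CARD('a)) \<alpha> (carrier_vec n)
       (indep_sum_pmf (pmf_of_set C) W) (pmf_of_set (carrier_vec n))"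

end

theory Submission
  imports Defs
begin

text \<open>
  Write \<open>X\<^sub>C(z) = \<Sum>d\<in>C. W (z - d)\<close>. Since \<open>X\<^sub>C\<close> is constant on the cosets of \<open>C\<close>,
  \<open>q powr ((\<alpha> - 1) * D\<^sub>\<alpha>)\<close> equals \<open>\<Sum>z. W z * (q ^ (n - k) * X\<^sub>C(z)) ^ (\<alpha> - 1)\<close>. Expand the power
  over tuples of codewords. The number of codes above a subspace depends only on its size, so a
  tuple of rank \<open>r\<close> lies in a random code with probability at most \<open>q powr (r * (k - n))\<close>. Tuples of
  full rank contribute at most 1. If \<open>t = \<alpha> - 1 - r > 0\<close> vectors of a tuple lie in the span of the
  others, Young's inequality bounds its contribution, up to a constant, by
  \<open>q powr (t * (n - k)) * (\<Sum>x. W x ^ (t + 1))\<close>, and interpolation between the exponents \<open>1\<close> and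
  \<open>\<alpha>\<close> turns this into \<open>q powr (t * (n - k - H\<^sub>\<alpha>)) \<le> q powr (- \<epsilon> * n * t)\<close>.
\<close>

section \<open>Counting codes above a subspace\<close>

lemma card_field_gt_1: "CARD('a::{field,finite}) > 1"
  using card_mono[of UNIV "{0, 1 :: 'a}"] by simp

text \<open>Coordinates in a finite basis \<open>A\<close> are a bijection between the extensional
  functions on \<open>A\<close> and the carrier.\<close>

lemma card_carrier_vectorspace:
  fixes M :: "('a::{field,finite}, 'v) module"
  assumes "vectorspace (class_ring :: 'a ring) M" "vectorspace.fin_dim (class_ring :: 'a ring) M"
  shows "finite (carrier M)"
    and "card (carrier M) = CARD('a) ^ vectorspace.dim (class_ring :: 'a ring) M"
proof -
  interpret vectorspace "class_ring :: 'a ring" M by fact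
  obtain A where A: "finite A" "basis A" using finite_basis_exists[OF assms(2)] by blast
  have AM: "A \<subseteq> carrier M" using A(2) unfolding basis_def by blast
  let ?F = "A \<rightarrow>\<^sub>E (UNIV :: 'a set)"
  have uniq: "\<exists>!f. f \<in> ?F \<and> lincomb f A = v" if "v \<in> carrier M" for v
    using basis_criterion[OF A(1) AM] A(2) that by simp
  have "lincomb f A \<in> carrier M" if "f \<in> ?F" for f
    using AM that by (intro lincomb_closed) auto
  then have "bij_betw (\<lambda>f. lincomb f A) ?F (carrier M)"
    unfolding bij_betw_def inj_on_def using uniq by (auto simp: image_iff) metis+
  then have "card (carrier M) = card ?F" "finite (carrier M) = finite ?F"
    by (auto dest: bij_betw_same_card bij_betw_finite)
  then show "finite (carrier M)" "card (carrier M) = CARD('a) ^ dim"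
    using A dim_basis[of A] by (auto simp: card_PiE finite_PiE)
qed

lemma finite_carrier_vec [simp]: "finite (carrier_vec n :: 'a::{field,finite} vec set)"
  and card_carrier_vec: "card (carrier_vec n :: 'a vec set) = CARD('a) ^ n"
proof -
  interpret vec_space "TYPE('a)" n .
  note * = card_carrier_vectorspace[of "V :: ('a, 'a vec) module"]
  show "finite (carrier_vec n :: 'a vec set)" "card (carrier_vec n :: 'a vec set) = CARD('a) ^ n"
    using *[OF _ fin_dim] vectorspace_axioms dim_is_n by simp_all
qed

text \<open>Elementwise form of \<open>VectorSpace.subspace\<close>, which makes the closure
  conditions directly usable.\<close>

definition vec_subspace :: "nat \<Rightarrow> 'a::field vec set \<Rightarrow> bool" where
  "vec_subspace n U \<longleftrightarrow> U \<subseteq> carrier_vec n \<and> 0\<^sub>v n \<in> U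
     \<and> (\<forall>x\<in>U. \<forall>y\<in>U. x + y \<in> U) \<and> (\<forall>c. \<forall>x\<in>U. c \<cdot>\<^sub>v x \<in> U)"

lemma subspace_iff_vec_subspace:
  "VectorSpace.subspace class_ring U (module_vec TYPE('a::field) n) \<longleftrightarrow> vec_subspace n U"
proof -
  interpret vec_space "TYPE('a)" n .
  show ?thesis
    using vectorspace_axioms module_axioms
    unfolding VectorSpace.subspace_def submodule_def vec_subspace_def
    by (auto simp: module_vec_simps)
qed

lemma card_vec_subspace:
  fixes U :: "'a::{field,finite} vec set"
  assumes "vec_subspace n U"
  shows "card U = CARD('a) ^ vectorspace.dim class_ring (module_vec TYPE('a) n \<lparr>carrier := U\<rparr>)"
proof -
  interpret vec_space "TYPE('a)" n .
  have sub: "VectorSpace.subspace class_ring U V"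
    using assms by (simp add: subspace_iff_vec_subspace)
  interpret U: vectorspace class_ring "vs U" using subspace_is_vs[OF sub] .
  have "finite U" using assms finite_subset[OF _ finite_carrier_vec] by (auto simp: vec_subspace_def)
  moreover have "U.span U = U"
    using U.in_own_span[of U] U.span_is_subset2[of U] by auto
  ultimately have "U.fin_dim" unfolding U.fin_dim_def by auto
  then show ?thesis using card_carrier_vectorspace[of "vs U"] U.vectorspace_axioms by simp
qed

text \<open>As q > 1, the size q^d of a subspace determines d, so later counts can work with
  cardinality in place of dimension.\<close>

lemma linear_codes_eq:
  "linear_codes n k = {C :: 'a::{field,finite} vec set. vec_subspace n C \<and> card C = CARD('a) ^ k}"
  unfolding linear_codes_def using card_field_gt_1[where 'a='a]
  by (auto simp: subspace_iff_vec_subspace card_vec_subspace)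

text \<open>The witness consists of the vectors supported on the first \<open>k\<close> coordinates.
  Nonemptiness is what gives \<open>pmf_of_set\<close> its meaning on the set of codes.\<close>

lemma linear_codes_nonempty:
  assumes "k \<le> n"
  shows "linear_codes n k \<noteq> ({} :: 'a::{field,finite} vec set set)"
proof -
  let ?f = "\<lambda>v :: 'a vec. vec n (\<lambda>i. if i < k then v $ i else 0)"
  let ?C = "?f ` carrier_vec k"
  have "inj_on ?f (carrier_vec k)"
  proof (rule inj_onI)
    fix x y :: "'a vec" assume xy: "x \<in> carrier_vec k" "y \<in> carrier_vec k" "?f x = ?f y"
    have "x $ i = y $ i" if "i < k" for i
      using arg_cong[OF xy(3), of "\<lambda>v. v $ i"] that assms by simp
    then show "x = y" using xy by auto
  qed
  then have "card ?C = CARD('a) ^ k" by (simp add: card_image card_carrier_vec)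
  moreover have "vec_subspace n ?C"
    unfolding vec_subspace_def
  proof (intro conjI ballI allI)
    have "0\<^sub>v n = ?f (0\<^sub>v k)" by (intro eq_vecI) auto
    then show "0\<^sub>v n \<in> ?C" by (rule image_eqI) simp
  next
    fix x y assume "x \<in> ?C" "y \<in> ?C"
    then obtain x' y' where *: "x = ?f x'" "y = ?f y'" "x' \<in> carrier_vec k" "y' \<in> carrier_vec k"
      by (elim imageE)
    then have "x + y = ?f (x' + y')" by (intro eq_vecI) auto
    then show "x + y \<in> ?C" by (rule image_eqI) (use * in simp)
  next
    fix c x assume "x \<in> ?C"
    then obtain x' where *: "x = ?f x'" "x' \<in> carrier_vec k" by (elim imageE)
    then have "c \<cdot>\<^sub>v x = ?f (c \<cdot>\<^sub>v x')" by (intro eq_vecI) auto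
    then show "c \<cdot>\<^sub>v x \<in> ?C" by (rule image_eqI) (use * in simp)
  qed auto
  ultimately show ?thesis by (auto simp: linear_codes_eq)
qed

lemma vec_subspaceD:
  assumes "vec_subspace n U"
  shows "U \<subseteq> carrier_vec n" "0\<^sub>v n \<in> U" "\<And>x y. x \<in> U \<Longrightarrow> y \<in> U \<Longrightarrow> x + y \<in> U"
    "\<And>c x. x \<in> U \<Longrightarrow> c \<cdot>\<^sub>v x \<in> U" "\<And>x y. x \<in> U \<Longrightarrow> y \<in> U \<Longrightarrow> x - y \<in> U"
proof -
  show *: "U \<subseteq> carrier_vec n" "0\<^sub>v n \<in> U" "\<And>x y. x \<in> U \<Longrightarrow> y \<in> U \<Longrightarrow> x + y \<in> U"
    "\<And>c x. x \<in> U \<Longrightarrow> c \<cdot>\<^sub>v x \<in> U"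
    using assms by (auto simp: vec_subspace_def)
  fix x y assume xy: "x \<in> U" "y \<in> U"
  then have "x - y = x + (-1) \<cdot>\<^sub>v y" using *(1) by (intro eq_vecI) auto
  then show "x - y \<in> U" using * xy by simp
qed

section \<open>Adjoining a vector: the span of a subspace and \<open>d\<close>\<close>

definition adjoin :: "'a::field vec set \<Rightarrow> 'a vec \<Rightarrow> 'a vec set" where
  "adjoin U d = (\<lambda>(c, u). c \<cdot>\<^sub>v d + u) ` (UNIV \<times> U)"

lemma adjoinI: "u \<in> U \<Longrightarrow> x = c \<cdot>\<^sub>v d + u \<Longrightarrow> x \<in> adjoin U d"
  unfolding adjoin_def by (rule image_eqI[of _ _ "(c, u)"]) auto

lemma vec_subspace_adjoin:
  assumes U: "vec_subspace n U" and d: "d \<in> carrier_vec n"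
  shows "vec_subspace n (adjoin U d)"
  unfolding vec_subspace_def
proof (intro conjI ballI allI)
  note U' = vec_subspaceD[OF U]
  show "adjoin U d \<subseteq> carrier_vec n" using U' d by (auto simp: adjoin_def)
  have "0\<^sub>v n = 0 \<cdot>\<^sub>v d + 0\<^sub>v n" using d by auto
  with U'(2) show "0\<^sub>v n \<in> adjoin U d" by (rule adjoinI)
  fix x assume "x \<in> adjoin U d"
  then obtain c u where x: "x = c \<cdot>\<^sub>v d + u" "u \<in> U" by (auto simp: adjoin_def)
  have "b \<cdot>\<^sub>v x = (b * c) \<cdot>\<^sub>v d + b \<cdot>\<^sub>v u" for b
    using x d U' by (intro eq_vecI) (auto simp: algebra_simps)
  then show "b \<cdot>\<^sub>v x \<in> adjoin U d" for b using U'(4)[OF x(2)] by (rule adjoinI[rotated])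
  fix y assume "y \<in> adjoin U d"
  then obtain c' u' where y: "y = c' \<cdot>\<^sub>v d + u'" "u' \<in> U" by (auto simp: adjoin_def)
  have "u \<in> carrier_vec n" "u' \<in> carrier_vec n" using x y U' by auto
  then have "x + y = (c + c') \<cdot>\<^sub>v d + (u + u')"
    using x y d by (intro eq_vecI) (auto simp: algebra_simps)
  then show "x + y \<in> adjoin U d" using U'(3)[OF x(2) y(2)] by (rule adjoinI[rotated])
qed

text \<open>Consequently the codes above \<open>adjoin U d\<close> are exactly the codes above
  \<open>U\<close> that contain \<open>d\<close>.\<close>

lemma adjoin_subset_iff:
  assumes "vec_subspace n U" "vec_subspace n C" "d \<in> carrier_vec n"
  shows "adjoin U d \<subseteq> C \<longleftrightarrow> U \<subseteq> C \<and> d \<in> C"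
proof -
  note U = vec_subspaceD[OF assms(1)] and C = vec_subspaceD[OF assms(2)]
  have "u = 0 \<cdot>\<^sub>v d + u" if "u \<in> U" for u using that U(1) assms(3) by (intro eq_vecI) auto
  then have "U \<subseteq> adjoin U d" using adjoinI by (metis subsetI)
  moreover have "d = 1 \<cdot>\<^sub>v d + 0\<^sub>v n" using assms(3) by simp
  with U(2) have "d \<in> adjoin U d" by (rule adjoinI)
  ultimately show ?thesis using C by (auto simp: adjoin_def subset_iff)
qed

lemma card_adjoin:
  fixes U :: "'a::{field,finite} vec set"
  assumes "vec_subspace n U" "d \<in> carrier_vec n" "d \<notin> U"
  shows "card (adjoin U d) = CARD('a) * card U"
proof -
  note U = vec_subspaceD[OF assms(1)]
  have "inj_on (\<lambda>(c, u). c \<cdot>\<^sub>v d + u) (UNIV \<times> U)"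
  proof (clarsimp simp: inj_on_def)
    fix c u c' u' assume u: "u \<in> U" "u' \<in> U" and eq: "c \<cdot>\<^sub>v d + u = c' \<cdot>\<^sub>v d + u'"
    have carr: "u \<in> carrier_vec n" "u' \<in> carrier_vec n" using u U by auto
    have ix: "c * d $ i + u $ i = c' * d $ i + u' $ i" if "i < n" for i
      using arg_cong[OF eq, of "\<lambda>v. v $ i"] that carr assms(2) by simp
    have c: "c = c'"
    proof (rule ccontr)
      assume "c \<noteq> c'"
      \<comment> \<open>Two representations with different coefficients can be solved for
        \<open>d\<close>, which puts \<open>d\<close> into \<open>U\<close>.\<close>
      have "d = inverse (c - c') \<cdot>\<^sub>v (u' - u)"
      proof (intro eq_vecI)
        fix i assume "i < dim_vec (inverse (c - c') \<cdot>\<^sub>v (u' - u))"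
        then have i: "i < n" using carr by simp
        have "(c - c') * d $ i = u' $ i - u $ i" using ix[OF i] by (simp add: algebra_simps)
        then have "d $ i = inverse (c - c') * (u' $ i - u $ i)"
          using \<open>c \<noteq> c'\<close> by (simp add: field_simps)
        then show "d $ i = (inverse (c - c') \<cdot>\<^sub>v (u' - u)) $ i" using i carr by simp
      qed (use carr assms(2) in auto)
      then show False using U u assms(3) by metis
    qed
    then have "u = u'" using ix carr by (intro eq_vecI) auto
    with c show "c = c' \<and> u = u'" by simp
  qed
  then show ?thesis unfolding adjoin_def by (simp add: card_image card_cartesian_product)
qed

definition codes_above :: "nat \<Rightarrow> nat \<Rightarrow> 'a::{field,finite} vec set \<Rightarrow> 'a vec set set" where
  "codes_above n k U = {C \<in> linear_codes n k. U \<subseteq> C}"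

lemma finite_linear_codes [simp]: "finite (linear_codes n k :: 'a::{field,finite} vec set set)"
proof (rule finite_subset)
  show "linear_codes n k \<subseteq> Pow (carrier_vec n :: 'a vec set)"
    by (auto simp: linear_codes_eq vec_subspace_def)
qed simp

lemma finite_codes_above [simp]: "finite (codes_above n k U)"
  by (simp add: codes_above_def)

text \<open>Double counting of the pairs \<open>(C, d)\<close> with \<open>U \<subseteq> C\<close> and \<open>d \<in> C - U\<close>.\<close>

lemma sum_card_codes_above:
  fixes U :: "'a::{field,finite} vec set"
  assumes "vec_subspace n U"
  shows "(\<Sum>d\<in>carrier_vec n - U. real (card (codes_above n k (adjoin U d))))
    = real (card (codes_above n k U)) * (real CARD('a) ^ k - real (card U))"
proof -
  let ?B = "codes_above n k U"
  note U = vec_subspaceD[OF assms]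
  have eq: "codes_above n k (adjoin U d) = {C \<in> ?B. d \<in> C}" if "d \<in> carrier_vec n" for d
    using that assms adjoin_subset_iff unfolding codes_above_def linear_codes_eq by blast
  have "(\<Sum>d\<in>carrier_vec n - U. real (card (codes_above n k (adjoin U d))))
      = (\<Sum>d\<in>carrier_vec n - U. \<Sum>C\<in>?B. of_bool (d \<in> C))"
    by (intro sum.cong refl) (simp add: eq Int_def)
  also have "\<dots> = (\<Sum>C\<in>?B. \<Sum>d\<in>carrier_vec n - U. of_bool (d \<in> C))"
    by (rule sum.swap)
  also have "\<dots> = (\<Sum>C\<in>?B. real CARD('a) ^ k - real (card U))"
  proof (rule sum.cong[OF refl])
    fix C assume C: "C \<in> ?B"
    then have Cc: "C \<subseteq> carrier_vec n" "U \<subseteq> C" "card C = CARD('a) ^ k"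
      by (auto simp: codes_above_def linear_codes_eq vec_subspace_def)
    have fin: "finite C" by (rule finite_subset[OF Cc(1)]) simp
    have "(carrier_vec n - U) \<inter> C = C - U" using Cc by auto
    then have "(\<Sum>d\<in>carrier_vec n - U. of_bool (d \<in> C)) = real (card (C - U))" by simp
    also have "\<dots> = real (card C) - real (card U)"
      using Cc(2) fin by (simp add: card_Diff_subset finite_subset card_mono of_nat_diff)
    finally show "(\<Sum>d\<in>carrier_vec n - U. of_bool (d \<in> C)) = real CARD('a) ^ k - real (card U)"
      using Cc by simp
  qed
  finally show ?thesis by simp
qed

text \<open>Downward induction on the size of \<open>U\<close>: the double count determines the number of codes
  above \<open>U\<close> from the numbers for the larger spaces \<open>adjoin U d\<close>.\<close>

lemma card_codes_above_cong:
  fixes U U' :: "'a::{field,finite} vec set"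
  assumes "vec_subspace n U" "vec_subspace n U'" "card U = card U'"
  shows "card (codes_above n k U) = card (codes_above n k U')"
proof -
  have q: "CARD('a) > 1" by (rule card_field_gt_1)
  have fin: "finite S" if "vec_subspace n S" for S :: "'a vec set"
    using vec_subspaceD(1)[OF that] finite_subset by fastforce
  have large: "codes_above n k S = {}" if "vec_subspace n S" "card S > CARD('a) ^ k" for S :: "'a vec set"
  proof (rule ccontr)
    assume "codes_above n k S \<noteq> {}"
    then obtain C where "vec_subspace n C" "card C = CARD('a) ^ k" "S \<subseteq> C"
      by (auto simp: codes_above_def linear_codes_eq)
    then show False using card_mono[OF fin, of C S] that by simp
  qed
  \<comment> \<open>\<open>j\<close> is the codimension of \<open>U\<close> in a code. For
    \<open>j = 0\<close> the only code above \<open>U\<close> is \<open>U\<close> itself; adjoining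
    a vector lowers \<open>j\<close> by one.\<close>
  have main: "card (codes_above n k U) = card (codes_above n k U')"
    if "vec_subspace n U" "vec_subspace n U'" "card U = card U'" "card U * CARD('a) ^ j = CARD('a) ^ k"
    for j and U U' :: "'a vec set"
    using that
  proof (induction j arbitrary: U U')
    case 0
    have "codes_above n k S = {S}" if "vec_subspace n S" "card S = CARD('a) ^ k" for S :: "'a vec set"
    proof -
      have "C = S" if "vec_subspace n C" "card C = CARD('a) ^ k" "S \<subseteq> C" for C
        using card_subset_eq[OF fin[OF that(1)] that(3)] that(2) \<open>card S = _\<close> by simp
      then show ?thesis using that by (auto simp: codes_above_def linear_codes_eq)
    qed
    then show ?case using 0 by simp
  next
    case (Suc j)
    \<comment> \<open>In the double count this factor multiplies the unknown number of codes; being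
      nonzero, it can be cancelled.\<close>
    have proper: "real CARD('a) ^ k - real (card U) > 0"
    proof -
      have "card U > 0" 
        using fin[OF Suc.prems(1)] vec_subspaceD(2)[OF Suc.prems(1)] by (auto simp: card_gt_0_iff)
      then have "card U < card U * CARD('a) ^ Suc j" using q one_less_power[OF q, of "Suc j"] by simp
      then have "card U < CARD('a) ^ k" unfolding Suc.prems(4) .
      then have "real (card U) < real (CARD('a) ^ k)" by (simp only: of_nat_less_iff)
      then show ?thesis by simp
    qed
    have same: "card (codes_above n k (adjoin U d)) = card (codes_above n k (adjoin U' d'))"
      if "d \<in> carrier_vec n - U" "d' \<in> carrier_vec n - U'" for d d'
      using that Suc.prems by (intro Suc.IH) (auto simp: vec_subspace_adjoin card_adjoin mult_ac)
    have compl: "card (carrier_vec n - U) = card (carrier_vec n - U')"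
      using Suc.prems fin by (simp add: card_Diff_subset vec_subspaceD(1))
    have "(\<Sum>d\<in>carrier_vec n - U. real (card (codes_above n k (adjoin U d))))
        = (\<Sum>d\<in>carrier_vec n - U'. real (card (codes_above n k (adjoin U' d))))"
    proof -
      obtain h where h: "bij_betw h (carrier_vec n - U) (carrier_vec n - U')"
        using finite_same_card_bij[OF _ _ compl] by auto
      have "(\<Sum>d\<in>carrier_vec n - U. real (card (codes_above n k (adjoin U d))))
          = (\<Sum>d\<in>carrier_vec n - U. real (card (codes_above n k (adjoin U' (h d)))))"
        using same bij_betwE[OF h] by (intro sum.cong refl) simp
      also have "\<dots> = (\<Sum>d\<in>carrier_vec n - U'. real (card (codes_above n k (adjoin U' d))))"
        by (rule sum.reindex_bij_betw[OF h])
      finally show ?thesis .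
    qed
    then show ?case
      using sum_card_codes_above[OF Suc.prems(1), of k] sum_card_codes_above[OF Suc.prems(2), of k]
        proper Suc.prems(3) by simp
  qed
  obtain e where e: "card U = CARD('a) ^ e" using card_vec_subspace[OF assms(1)] by blast
  show ?thesis
  proof (cases "e \<le> k")
    case True
    then show ?thesis using main[OF assms, of "k - e"] e by (simp flip: power_add)
  next
    case False
    then have "card U > CARD('a) ^ k" using e q by simp
    then show ?thesis using large assms by simp
  qed
qed

text \<open>All spaces \<open>adjoin U d\<close> have equally many codes above them, so the double
  count gives the ratio (q^k - u) / (q^n - u) with u = \<open>card U\<close>. As k \<le> n, this is
  at most q^k / q^n.\<close>

lemma card_codes_above_adjoin_le:
  fixes U :: "'a::{field,finite} vec set"
  assumes U: "vec_subspace n U" and d: "d \<in> carrier_vec n" "d \<notin> U" and "k \<le> n"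
  shows "real (card (codes_above n k (adjoin U d)))
    \<le> real CARD('a) ^ k / real CARD('a) ^ n * real (card (codes_above n k U))"
proof -
  let ?q = "real CARD('a)" and ?u = "real (card U)"
  let ?N = "real (card (codes_above n k U))" and ?M = "real (card (codes_above n k (adjoin U d)))"
  note Uc = vec_subspaceD(1)[OF U]
  have fin: "finite U" using Uc finite_subset by fastforce
  have "card U < card (carrier_vec n :: 'a vec set)"
    using d Uc by (intro psubset_card_mono) auto
  then have "real (card U) < real (CARD('a) ^ n)" by (simp only: of_nat_less_iff card_carrier_vec)
  then have pos: "?u < ?q ^ n" by simp
  have "(\<Sum>d'\<in>carrier_vec n - U. real (card (codes_above n k (adjoin U d'))))
      = (\<Sum>d'\<in>carrier_vec n - U. ?M)"
    using U d by (intro sum.cong refl arg_cong[of _ _ real] card_codes_above_cong[of n])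
      (auto simp: vec_subspace_adjoin card_adjoin)
  also have "\<dots> = (?q ^ n - ?u) * ?M"
    using card_mono[OF _ Uc] Uc fin by (simp add: card_Diff_subset card_carrier_vec of_nat_diff)
  finally have "(?q ^ n - ?u) * ?M = ?N * (?q ^ k - ?u)"
    using sum_card_codes_above[OF U, of k] by simp
  moreover have "?q ^ n * (?q ^ k - ?u) \<le> ?q ^ k * (?q ^ n - ?u)"
    using \<open>k \<le> n\<close> by (simp add: algebra_simps mult_left_mono power_increasing)
  then have "?q ^ n * (?N * (?q ^ k - ?u)) \<le> ?N * (?q ^ k * (?q ^ n - ?u))"
    by (simp add: mult_left_mono mult.left_commute[of _ ?N])
  ultimately have "?q ^ n * ((?q ^ n - ?u) * ?M) \<le> ?N * (?q ^ k * (?q ^ n - ?u))" by metis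
  then have "(?q ^ n - ?u) * (?q ^ n * ?M) \<le> (?q ^ n - ?u) * (?q ^ k * ?N)"
    by (simp add: algebra_simps)
  then have "?q ^ n * ?M \<le> ?q ^ k * ?N" using pos by (simp add: mult_le_cancel_left)
  then show ?thesis by (simp add: field_simps)
qed

section \<open>Averages along linear combinations of noise vectors\<close>

text \<open>The sum is at most \<open>card A\<close> times its largest term. The crude constant is
  harmless: \<open>A\<close> will be the field, whose size does not depend on n.\<close>

lemma sum_power_le:
  fixes f :: "'b \<Rightarrow> real"
  assumes "finite A" "A \<noteq> {}" "\<And>i. i \<in> A \<Longrightarrow> f i \<ge> 0"
  shows "(\<Sum>i\<in>A. f i) ^ t \<le> real (card A) ^ t * (\<Sum>i\<in>A. f i ^ t)"
proof -
  have "Max (f ` A) \<in> f ` A" using assms by (intro Max_in) auto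
  then obtain j where j: "j \<in> A" "f j = Max (f ` A)" by auto
  have "(\<Sum>i\<in>A. f i) \<le> real (card A) * f j"
    using assms(1) j by (intro sum_bounded_above) auto
  then have "(\<Sum>i\<in>A. f i) ^ t \<le> (real (card A) * f j) ^ t"
    using assms by (intro power_mono sum_nonneg) auto
  also have "\<dots> = real (card A) ^ t * f j ^ t" by (simp add: power_mult_distrib)
  also have "\<dots> \<le> real (card A) ^ t * (\<Sum>i\<in>A. f i ^ t)"
    using assms j by (intro mult_left_mono member_le_sum) auto
  finally show ?thesis .
qed

text \<open>For d \<noteq> 0 this sums \<open>g\<close> over the line through \<open>x\<close> with
  direction \<open>d\<close>; for d = 0 it is q times \<open>g x\<close>.\<close>

definition shift_sum :: "('a::{field,finite} vec \<Rightarrow> real) \<Rightarrow> 'a vec \<Rightarrow> 'a vec \<Rightarrow> real" where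
  "shift_sum g d x = (\<Sum>c\<in>UNIV. g (x - c \<cdot>\<^sub>v d))"

lemma minus_zero_smult_vec:
  fixes x :: "'a::ring vec"
  assumes "x \<in> carrier_vec n" "d \<in> carrier_vec n"
  shows "x - 0 \<cdot>\<^sub>v d = x"
  using assms by (intro eq_vecI) auto

lemma shift_sum_nonneg:
  assumes "\<And>x. g x \<ge> 0"
  shows "shift_sum g d x \<ge> 0"
  unfolding shift_sum_def using assms by (simp add: sum_nonneg)

lemma shift_sum_ge:
  fixes g :: "'a::{field,finite} vec \<Rightarrow> real"
  assumes "\<And>x. g x \<ge> 0" "x \<in> carrier_vec n" "d \<in> carrier_vec n"
  shows "g x \<le> shift_sum g d x"
proof -
  have "g (x - 0 \<cdot>\<^sub>v d) \<le> shift_sum g d x"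
    unfolding shift_sum_def using assms(1) by (intro member_le_sum) auto
  then show ?thesis by (simp add: minus_zero_smult_vec[OF assms(2,3)])
qed

lemma shift_sum_power_le:
  fixes g :: "'a::{field,finite} vec \<Rightarrow> real"
  assumes "\<And>x. g x \<ge> 0"
  shows "shift_sum g d x ^ t \<le> real CARD('a) ^ t * shift_sum (\<lambda>y. g y ^ t) d x"
  unfolding shift_sum_def using assms by (intro sum_power_le) auto

text \<open>Each \<open>c\<close> contributes the mass of one translate of \<open>U\<close>, which
  \<open>g\<close> dominates. If \<open>d\<close> already lies in \<open>U\<close>, elements of
  \<open>adjoin U d\<close> arise from several pairs \<open>(c, u)\<close>, hence
  \<open>sum_image_le\<close>.\<close>

lemma sum_adjoin_le:
  fixes w g :: "'a::{field,finite} vec \<Rightarrow> real"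
  assumes U: "vec_subspace n U" and d: "d \<in> carrier_vec n" and x: "x \<in> carrier_vec n"
    and w: "\<And>x. w x \<ge> 0" and g: "\<And>x. x \<in> carrier_vec n \<Longrightarrow> (\<Sum>u\<in>U. w (x - u)) \<le> g x"
  shows "(\<Sum>u\<in>adjoin U d. w (x - u)) \<le> shift_sum g d x"
proof -
  note Uc = vec_subspaceD(1)[OF U]
  have fin: "finite U" using Uc finite_subset by fastforce
  have "(\<Sum>u\<in>adjoin U d. w (x - u)) \<le> (\<Sum>(c, u)\<in>UNIV \<times> U. w (x - (c \<cdot>\<^sub>v d + u)))"
    unfolding adjoin_def
    using sum_image_le[of "UNIV \<times> U" "\<lambda>u. w (x - u)" "\<lambda>(c, u). c \<cdot>\<^sub>v d + u"] fin w
    by (simp add: case_prod_unfold o_def)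
  also have "\<dots> = (\<Sum>c\<in>UNIV. \<Sum>u\<in>U. w (x - (c \<cdot>\<^sub>v d + u)))"
    by (simp add: sum.cartesian_product)
  also have "\<dots> = (\<Sum>c\<in>UNIV. \<Sum>u\<in>U. w ((x - c \<cdot>\<^sub>v d) - u))"
  proof (intro sum.cong refl arg_cong[of _ _ w])
    fix c u assume "u \<in> U"
    then show "x - (c \<cdot>\<^sub>v d + u) = (x - c \<cdot>\<^sub>v d) - u" using Uc x d by (intro eq_vecI) auto
  qed
  also have "\<dots> \<le> shift_sum g d x"
    unfolding shift_sum_def using x d by (intro sum_mono g) auto
  finally show ?thesis .
qed

section \<open>Reindexing of sums over the whole space, and elementary inequalities\<close>

lemma sum_carrier_vec_reflect:
  fixes f :: "'a::{field,finite} vec \<Rightarrow> real"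
  assumes "z \<in> carrier_vec n"
  shows "(\<Sum>d\<in>carrier_vec n. f (z - d)) = (\<Sum>d\<in>carrier_vec n. f d)"
proof (rule sum.reindex_bij_witness[of _ "\<lambda>d. z - d" "\<lambda>d. z - d"])
  fix d :: "'a vec" assume "d \<in> carrier_vec n"
  then show "z - (z - d) = d" using assms by (intro eq_vecI) auto
  then show "z - (z - d) = d" .
qed (use assms in auto)

lemma sum_carrier_vec_dilate:
  fixes f :: "'a::{field,finite} vec \<Rightarrow> real"
  assumes x: "x \<in> carrier_vec n" and c: "c \<noteq> 0"
  shows "(\<Sum>d\<in>carrier_vec n. f (x - c \<cdot>\<^sub>v d)) = (\<Sum>d\<in>carrier_vec n. f d)"
proof (rule sum.reindex_bij_witness[of _ "\<lambda>d. inverse c \<cdot>\<^sub>v (x - d)" "\<lambda>d. x - c \<cdot>\<^sub>v d"])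
  fix d :: "'a vec" assume d: "d \<in> carrier_vec n"
  show "inverse c \<cdot>\<^sub>v (x - (x - c \<cdot>\<^sub>v d)) = d" using x c d by (intro eq_vecI) auto
  show "x - c \<cdot>\<^sub>v (inverse c \<cdot>\<^sub>v (x - d)) = d" using x c d by (intro eq_vecI) (auto simp: field_simps)
qed (use x in auto)

lemma sum_carrier_vec_translate:
  fixes f :: "'a::{field,finite} vec \<Rightarrow> real"
  assumes "c \<in> carrier_vec n"
  shows "(\<Sum>y\<in>carrier_vec n. f (y - c)) = (\<Sum>y\<in>carrier_vec n. f y)"
proof (rule sum.reindex_bij_witness[of _ "\<lambda>y. y + c" "\<lambda>y. y - c"])
  fix y :: "'a vec" assume "y \<in> carrier_vec n"
  then show "y - c + c = y" "y + c - c = y" using assms by (auto intro!: eq_vecI)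
qed (use assms in auto)

text \<open>Young's inequality, obtained from Bernoulli's inequality at a/b - 1 \<ge> -1 by
  multiplying with b^(t+1).\<close>

lemma mult_power_le:
  fixes a b :: real
  assumes "a \<ge> 0" "b \<ge> 0"
  shows "real (Suc t) * (a * b ^ t) \<le> a ^ Suc t + real t * b ^ Suc t"
proof (cases "b = 0")
  case True
  then show ?thesis using assms by (cases t) auto
next
  case False
  then have b: "b > 0" using assms by simp
  have "1 + real (Suc t) * (a / b - 1) \<le> (1 + (a / b - 1)) ^ Suc t"
    using assms b by (intro Bernoulli_inequality) simp
  then have "(1 + real (Suc t) * (a / b - 1)) * b ^ Suc t \<le> (a / b) ^ Suc t * b ^ Suc t"
    using b by (intro mult_right_mono) auto
  also have "\<dots> = a ^ Suc t" using b by (simp add: power_divide)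
  also have "(1 + real (Suc t) * (a / b - 1)) * b ^ Suc t
      = real (Suc t) * (a * b ^ t) - real t * b ^ Suc t"
    using b by (simp add: field_simps)
  finally show ?thesis by simp
qed

text \<open>Pascal's rule for one further factor, which raises either the second index of
  \<open>F\<close> or the first.\<close>

lemma pascal_sum:
  fixes F :: "nat \<Rightarrow> nat \<Rightarrow> real"
  shows "(\<Sum>t\<le>Suc j. real (Suc j choose t) * F (Suc j - t) t)
    = (\<Sum>t\<le>j. real (j choose t) * F (j - t) (Suc t)) + (\<Sum>t\<le>j. real (j choose t) * F (Suc (j - t)) t)"
proof -
  have "(\<Sum>t\<le>j. real (j choose t) * F (Suc (j - t)) t) = (\<Sum>t\<le>j. real (j choose t) * F (Suc j - t) t)"
    by (intro sum.cong refl) (simp add: Suc_diff_le)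
  \<comment> \<open>The added top term vanishes because \<open>j choose Suc j\<close> is 0.\<close>
  also have "\<dots> = (\<Sum>t\<le>Suc j. real (j choose t) * F (Suc j - t) t)" by simp
  also have "\<dots> = F (Suc j) 0 + (\<Sum>t\<le>j. real (j choose Suc t) * F (j - t) (Suc t))"
    by (subst sum.atMost_Suc_shift) simp
  finally show ?thesis
    by (subst sum.atMost_Suc_shift) (simp add: distrib_right sum.distrib)
qed

lemma sum_mult_add_swap:
  fixes f :: "'b \<Rightarrow> real"
  shows "(\<Sum>C\<in>B. f C * (c + (\<Sum>d\<in>D. h C d * v d)))
    = c * (\<Sum>C\<in>B. f C) + (\<Sum>d\<in>D. v d * (\<Sum>C\<in>B. f C * h C d))"
proof -
  have "(\<Sum>C\<in>B. \<Sum>d\<in>D. f C * (h C d * v d)) = (\<Sum>d\<in>D. \<Sum>C\<in>B. f C * (h C d * v d))"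
    by (rule sum.swap)
  then show ?thesis by (simp add: distrib_left sum.distrib sum_distrib_left mult_ac)
qed

section \<open>Averages of the noise along a growing span\<close>

locale noise =
  fixes n :: nat and q :: real and w :: "'a::{field,finite} vec \<Rightarrow> real"
  assumes q_eq: "q = real CARD('a)" and w_nonneg: "w x \<ge> 0" and sum_w: "(\<Sum>x\<in>carrier_vec n. w x) = 1"
begin

abbreviation "V \<equiv> carrier_vec n :: 'a vec set"

lemma q_gt_1: "q > 1"
  using card_field_gt_1[where 'a='a] by (simp add: q_eq)

lemma sum_w_reflect: "z \<in> V \<Longrightarrow> (\<Sum>d\<in>V. w (z - d)) = 1"
  using sum_carrier_vec_reflect[of z n w] sum_w by simp

text \<open>Here \<open>g\<close> dominates the mass that \<open>w\<close> gives to the translates of a subspace \<open>U\<close>, and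
  \<open>shift_sum g d\<close> does the same for \<open>adjoin U d\<close>. So \<open>avg l t g z\<close> accounts for \<open>l\<close> codewords that
  successively enlarge \<open>U\<close> and \<open>t\<close> codewords that stay in the final span.\<close>

primrec avg :: "nat \<Rightarrow> nat \<Rightarrow> ('a vec \<Rightarrow> real) \<Rightarrow> 'a vec \<Rightarrow> real" where
  "avg 0 t g z = g z ^ t"
| "avg (Suc l) t g z = (\<Sum>d\<in>V. w (z - d) * avg l t (shift_sum g d) z)"

lemma avg_nonneg: "(\<And>x. g x \<ge> 0) \<Longrightarrow> avg l t g z \<ge> 0"
  by (induction l arbitrary: g) (auto intro!: sum_nonneg mult_nonneg_nonneg w_nonneg shift_sum_nonneg)

text \<open>Only the weights \<open>w (z - d)\<close> remain, and they sum to 1. This is the source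
  of the leading 1 in the final bound.\<close>

lemma avg_0_right: "z \<in> V \<Longrightarrow> avg l 0 g z = 1"
  by (induction l arbitrary: g) (auto simp: sum_w_reflect)

text \<open>The term c = 0 of each shift keeps \<open>h\<close> below the current function at
  \<open>z\<close>, so at the bottom of the recursion \<open>h\<close> is absorbed as one more
  power.\<close>

lemma mult_avg_le:
  assumes "\<And>x. g x \<ge> 0" "0 \<le> h" "h \<le> g z" "z \<in> V"
  shows "h * avg l t g z \<le> avg l (Suc t) g z"
  using assms
proof (induction l arbitrary: g)
  case 0
  then show ?case by (simp add: mult_right_mono)
next
  case (Suc l)
  have "h * avg (Suc l) t g z = (\<Sum>d\<in>V. w (z - d) * (h * avg l t (shift_sum g d) z))"
    by (simp add: sum_distrib_left mult.left_commute)
  also have "\<dots> \<le> (\<Sum>d\<in>V. w (z - d) * avg l (Suc t) (shift_sum g d) z)"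
  proof (intro sum_mono mult_left_mono w_nonneg Suc.IH)
    fix d assume "d \<in> V"
    then show "h \<le> shift_sum g d z"
      using shift_sum_ge[of g z n d] Suc.prems by simp
  qed (use Suc.prems shift_sum_nonneg in auto)
  finally show ?case by simp
qed

section \<open>Exponent 1, where \<open>avg\<close> is monotone and linear in
  \<open>g\<close>\<close>

lemma avg_mono:
  assumes "\<And>x. x \<in> V \<Longrightarrow> f x \<le> g x" "z \<in> V"
  shows "avg l 1 f z \<le> avg l 1 g z"
  using assms(1)
proof (induction l arbitrary: f g)
  case (Suc l)
  show ?case
    unfolding avg.simps
  proof (intro sum_mono mult_left_mono w_nonneg Suc.IH)
    fix d x assume "d \<in> V" "x \<in> V"
    then show "shift_sum f d x \<le> shift_sum g d x"
      unfolding shift_sum_def by (intro sum_mono Suc.prems) auto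
  qed
qed (use assms(2) in auto)

lemma avg_sum:
  "avg l 1 (\<lambda>x. \<Sum>i\<in>I. b i * f i x) z = (\<Sum>i\<in>I. b i * avg l 1 (f i) z)"
proof (induction l arbitrary: f)
  case (Suc l)
  have *: "shift_sum (\<lambda>x. \<Sum>i\<in>I. b i * f i x) d = (\<lambda>x. \<Sum>i\<in>I. b i * shift_sum (f i) d x)" for d
    unfolding shift_sum_def sum_distrib_left by (rule ext, rule sum.swap)
  show ?case
    unfolding avg.simps * Suc.IH sum_distrib_left
    by (subst sum.swap) (simp add: mult.left_commute)
qed simp

lemma avg_scale: "avg l 1 (\<lambda>x. b * f x) z = b * avg l 1 f z"
  using avg_sum[of l "\<lambda>_. b" "\<lambda>_. f" "{()}" z] by simp

lemma avg_add: "avg l 1 (\<lambda>x. f x + g x) z = avg l 1 f z + avg l 1 g z"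
  using avg_sum[of l "\<lambda>_. 1" "\<lambda>b. if b then f else g" UNIV z] by (simp add: UNIV_bool add.commute)

lemma avg_const: "z \<in> V \<Longrightarrow> avg l 1 (\<lambda>_. M) z = q ^ l * M"
proof (induction l arbitrary: M)
  case (Suc l)
  have "shift_sum (\<lambda>_. M) d = (\<lambda>_. q * M)" for d :: "'a vec"
    by (rule ext) (simp add: shift_sum_def q_eq)
  then show ?case using Suc by (simp add: sum_w_reflect flip: sum_distrib_right)
qed simp

text \<open>A shift sums q terms, so moving the power inside costs a factor q^t per shift.
  Afterwards the exponent is 1 and linearity is available.\<close>

lemma avg_le_avg_power:
  assumes "\<And>x. g x \<ge> 0" "z \<in> V"
  shows "avg l t g z \<le> q ^ (t * l) * avg l 1 (\<lambda>x. g x ^ t) z"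
  using assms(1)
proof (induction l arbitrary: g)
  case (Suc l)
  have "avg (Suc l) t g z
      \<le> (\<Sum>d\<in>V. w (z - d) * (q ^ (t * l) * avg l 1 (\<lambda>x. shift_sum g d x ^ t) z))"
    unfolding avg.simps using Suc.prems
    by (intro sum_mono mult_left_mono w_nonneg Suc.IH shift_sum_nonneg)
  also have "\<dots> \<le> (\<Sum>d\<in>V. w (z - d) *
      (q ^ (t * l) * avg l 1 (\<lambda>x. q ^ t * shift_sum (\<lambda>y. g y ^ t) d x) z))"
    using Suc.prems assms(2)
    by (intro sum_mono mult_left_mono w_nonneg avg_mono shift_sum_power_le[where 'a='a, folded q_eq]) (auto simp: q_eq)
  also have "\<dots> = q ^ (t * Suc l) * avg (Suc l) 1 (\<lambda>x. g x ^ t) z"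
    unfolding avg_scale by (simp add: sum_distrib_left power_add mult_ac)
  finally show ?case .
qed simp

text \<open>Splitting off the term \<open>c = 0\<close> of the innermost shift leaves \<open>f\<close> itself; in every other
  term the average over \<open>d\<close> is already bounded by \<open>M\<close>, uniformly in the point.\<close>

lemma sum_avg_le:
  assumes "(\<Sum>z\<in>V. w z * f z) \<le> M"
    and M: "\<And>c x z. c \<noteq> 0 \<Longrightarrow> x \<in> V \<Longrightarrow> z \<in> V \<Longrightarrow> (\<Sum>d\<in>V. w (z - d) * f (x - c \<cdot>\<^sub>v d)) \<le> M"
  shows "(\<Sum>z\<in>V. w z * avg l 1 f z) \<le> q ^ l * M"
proof (induction l)
  case 0
  then show ?case using assms by simp
next
  case (Suc l)
  have q1: "q \<ge> 1" using q_gt_1 by simp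
  have step: "avg (Suc l) 1 f z \<le> avg l 1 f z + (q - 1) * (q ^ l * M)" if z: "z \<in> V" for z
  proof -
    \<comment> \<open>Linearity moves the sum over \<open>d\<close> inside, where it acts on
      \<open>f\<close> before the other \<open>l\<close> shifts.\<close>
    have "avg (Suc l) 1 f z = avg l 1 (\<lambda>x. \<Sum>d\<in>V. w (z - d) * shift_sum f d x) z"
      using avg_sum[of l "\<lambda>d. w (z - d)" "\<lambda>d. shift_sum f d" V z] by simp
    also have "\<dots> \<le> avg l 1 (\<lambda>x. f x + (q - 1) * M) z"
    proof (rule avg_mono[OF _ z])
      fix x assume x: "x \<in> V"
      have "(\<Sum>d\<in>V. w (z - d) * shift_sum f d x)
          = (\<Sum>c\<in>UNIV. \<Sum>d\<in>V. w (z - d) * f (x - c \<cdot>\<^sub>v d))"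
        unfolding shift_sum_def sum_distrib_left by (rule sum.swap)
      also have "\<dots> = (\<Sum>d\<in>V. w (z - d) * f (x - 0 \<cdot>\<^sub>v d))
          + (\<Sum>c\<in>UNIV - {0}. \<Sum>d\<in>V. w (z - d) * f (x - c \<cdot>\<^sub>v d))"
        by (rule sum.remove) auto
      also have "(\<Sum>d\<in>V. w (z - d) * f (x - 0 \<cdot>\<^sub>v d)) = (\<Sum>d\<in>V. w (z - d) * f x)"
        using x by (intro sum.cong refl) (simp add: minus_zero_smult_vec)
      also have "\<dots> = f x" using z by (simp add: sum_w_reflect flip: sum_distrib_right)
      also have "(\<Sum>c\<in>UNIV - {0}. \<Sum>d\<in>V. w (z - d) * f (x - c \<cdot>\<^sub>v d))
          \<le> real (card (UNIV - {0 :: 'a})) * M"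
        using M x z by (intro sum_bounded_above) auto
      also have "real (card (UNIV - {0 :: 'a})) = q - 1"
        by (simp add: q_eq card_Diff_singleton of_nat_diff Suc_leI)
      finally show "(\<Sum>d\<in>V. w (z - d) * shift_sum f d x) \<le> f x + (q - 1) * M" by simp
    qed
    also have "\<dots> = avg l 1 f z + (q - 1) * (q ^ l * M)"
      using z by (simp only: avg_add avg_const) (simp add: mult_ac)
    finally show ?thesis .
  qed
  have "(\<Sum>z\<in>V. w z * avg (Suc l) 1 f z)
      \<le> (\<Sum>z\<in>V. w z * (avg l 1 f z + (q - 1) * (q ^ l * M)))"
    by (intro sum_mono mult_left_mono w_nonneg step)
  also have "\<dots> = (\<Sum>z\<in>V. w z * avg l 1 f z) + (q - 1) * (q ^ l * M)"
    by (simp add: distrib_left sum.distrib sum_w flip: sum_distrib_right)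
  also have "\<dots> \<le> q ^ Suc l * M" using Suc by (simp add: algebra_simps)
  finally show ?case .
qed

lemma sum_avg_power_le:
  "(\<Sum>z\<in>V. w z * avg l t w z) \<le> q ^ (t * l) * (q ^ l * (\<Sum>x\<in>V. w x ^ Suc t))"
proof -
  let ?M = "\<Sum>x\<in>V. w x ^ Suc t"
  \<comment> \<open>Young's inequality separates the two factors. Since c \<noteq> 0, both arguments
    run through the whole space with \<open>d\<close>, so each power sum equals
    \<open>?M\<close>.\<close>
  have "(\<Sum>d\<in>V. w (z - d) * w (x - c \<cdot>\<^sub>v d) ^ t) \<le> ?M" if "c \<noteq> 0" "x \<in> V" "z \<in> V" for c x z
  proof -
    have "real (Suc t) * (\<Sum>d\<in>V. w (z - d) * w (x - c \<cdot>\<^sub>v d) ^ t)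
        \<le> (\<Sum>d\<in>V. w (z - d) ^ Suc t + real t * w (x - c \<cdot>\<^sub>v d) ^ Suc t)"
      unfolding sum_distrib_left by (intro sum_mono mult_power_le w_nonneg)
    also have "\<dots> = ?M + real t * ?M"
      using that sum_carrier_vec_reflect[of z n "\<lambda>x. w x ^ Suc t"]
        sum_carrier_vec_dilate[of x n c "\<lambda>x. w x ^ Suc t"]
      by (simp add: sum.distrib flip: sum_distrib_left)
    finally have "real (Suc t) * (\<Sum>d\<in>V. w (z - d) * w (x - c \<cdot>\<^sub>v d) ^ t) \<le> real (Suc t) * ?M"
      by (simp add: algebra_simps)
    then show ?thesis by (simp add: mult_le_cancel_left)
  qed
  then have *: "(\<Sum>z\<in>V. w z * avg l 1 (\<lambda>x. w x ^ t) z) \<le> q ^ l * ?M"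
    by (intro sum_avg_le) auto
  have "(\<Sum>z\<in>V. w z * avg l t w z) \<le> (\<Sum>z\<in>V. w z * (q ^ (t * l) * avg l 1 (\<lambda>x. w x ^ t) z))"
    by (intro sum_mono mult_left_mono w_nonneg avg_le_avg_power)
  also have "\<dots> = q ^ (t * l) * (\<Sum>z\<in>V. w z * avg l 1 (\<lambda>x. w x ^ t) z)"
    by (simp add: sum_distrib_left mult.left_commute)
  also have "\<dots> \<le> q ^ (t * l) * (q ^ l * ?M)" using * by (intro mult_left_mono) (auto simp: q_eq)
  finally show ?thesis .
qed

section \<open>Interpolation between power sums of the noise\<close>

lemma sum_power_w_pos: "(\<Sum>x\<in>V. w x ^ m) > 0"
proof -
  obtain x where "x \<in> V" "w x \<noteq> 0" using sum_w by (metis sum.neutral zero_neq_one)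
  moreover from this have "w x ^ m > 0" using w_nonneg[of x] by simp
  ultimately show ?thesis using w_nonneg by (intro sum_pos2[of V x]) auto
qed

text \<open>Hoelder interpolation between the exponents 1 and m + 1. Weighted AM-GM is applied
  pointwise to \<open>w x ^ m\<close> and \<open>L\<close> and summed against \<open>w\<close>,
  which has mass 1; with this \<open>L\<close> the two terms add up to L^(t/m).\<close>

lemma sum_power_le_sum_power:
  assumes "t \<le> m" "m \<ge> 1"
  shows "(\<Sum>x\<in>V. w x ^ Suc t) \<le> (\<Sum>x\<in>V. w x ^ Suc m) powr (t / m)"
proof -
  define L where "L = (\<Sum>x\<in>V. w x ^ Suc m)"
  have "L > 0" unfolding L_def by (rule sum_power_w_pos)
  let ?b = "t / m"
  have "w x ^ t \<le> ?b * (w x ^ m * L powr (?b - 1)) + (1 - ?b) * L powr ?b" for x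
  proof (cases "w x = 0")
    case True
    \<comment> \<open>For t = 0 the left side is 0^0 = 1, matched by \<open>L powr 0\<close>;
      otherwise it is 0.\<close>
    then show ?thesis using assms \<open>L > 0\<close> by (cases t) auto
  next
    case False
    then have pos: "w x > 0" using w_nonneg[of x] by simp
    have "(w x ^ m) powr ?b = w x ^ t"
      using pos assms by (simp add: powr_powr flip: powr_realpow)
    then have "w x ^ t * L powr (1 - ?b) \<le> ?b * w x ^ m + (1 - ?b) * L"
      using Youngs_inequality_0[of ?b "1 - ?b" "w x ^ m" L] pos \<open>L > 0\<close> assms by simp
    then have "w x ^ t * L powr (1 - ?b) * L powr (?b - 1)
        \<le> (?b * w x ^ m + (1 - ?b) * L) * L powr (?b - 1)"
      by (rule mult_right_mono) simp
    also have "w x ^ t * L powr (1 - ?b) * L powr (?b - 1) = w x ^ t"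
      using \<open>L > 0\<close> by (simp add: mult.assoc flip: powr_add)
    also have "(?b * w x ^ m + (1 - ?b) * L) * L powr (?b - 1)
        = ?b * (w x ^ m * L powr (?b - 1)) + (1 - ?b) * (L * L powr (?b - 1))"
      by (simp add: algebra_simps)
    also have "L * L powr (?b - 1) = L powr ?b" using \<open>L > 0\<close> by (simp add: powr_diff)
    finally show ?thesis .
  qed
  then have "(\<Sum>x\<in>V. w x * w x ^ t)
      \<le> (\<Sum>x\<in>V. w x * (?b * (w x ^ m * L powr (?b - 1)) + (1 - ?b) * L powr ?b))"
    by (intro sum_mono mult_left_mono w_nonneg)
  also have "\<dots> = ?b * L powr (?b - 1) * L + (1 - ?b) * L powr ?b * (\<Sum>x\<in>V. w x)"
  proof -
    have "(\<Sum>x\<in>V. w x * (A * (w x ^ m * P) + Q)) = A * P * (\<Sum>x\<in>V. w x ^ Suc m) + Q * (\<Sum>x\<in>V. w x)"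
      for A P Q :: real
      by (simp add: distrib_left sum.distrib sum_distrib_left mult_ac)
    then show ?thesis unfolding L_def .
  qed
  also have "\<dots> = L powr ?b"
    using \<open>L > 0\<close> by (simp add: sum_w powr_diff algebra_simps)
  finally show ?thesis by (simp add: L_def)
qed

text \<open>Each of the \<open>j\<close> factors \<open>\<Sum>d\<in>C. w (z - d)\<close> is split according to whether \<open>d\<close> lies in the
  span of the vectors chosen before. A vector outside costs a factor \<open>a\<close> in the number of
  codes; the sum over the vectors inside is dominated by \<open>g z\<close>.\<close>

lemma code_moment_le:
  fixes U :: "'a vec set" and k :: nat
  defines "a \<equiv> q ^ k / q ^ n"
  assumes "k \<le> n" and z: "z \<in> V"
    and "vec_subspace n U" "\<And>x. g x \<ge> 0"
    and "\<And>x. x \<in> V \<Longrightarrow> (\<Sum>u\<in>U. w (x - u)) \<le> g x"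
  shows "(\<Sum>C\<in>codes_above n k U. (\<Sum>d\<in>C. w (z - d)) ^ j)
    \<le> real (card (codes_above n k U)) * (\<Sum>t\<le>j. real (j choose t) * (a ^ (j - t) * avg (j - t) t g z))"
  using assms(4-)
proof (induction j arbitrary: U g)
  case 0
  then show ?case by simp
next
  case (Suc j)
  let ?N = "\<lambda>U. real (card (codes_above n k U))"
  let ?X = "\<lambda>C. \<Sum>d\<in>C. w (z - d)"
  let ?R = "\<lambda>g. \<Sum>t\<le>j. real (j choose t) * (a ^ (j - t) * avg (j - t) t g z)"
  have a: "a \<ge> 0" by (simp add: a_def q_eq)
  note U = vec_subspaceD(1)[OF Suc.prems(1)]
  have finU: "finite U" by (rule finite_subset[OF U]) simp
  \<comment> \<open>The indicator lets \<open>d\<close> range over a set independent of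
    \<open>C\<close>, so that the sums over codes and over \<open>d\<close> can be
    exchanged.\<close>
  have split: "?X C = ?X U + (\<Sum>d\<in>V - U. of_bool (d \<in> C) * w (z - d))"
    if "C \<in> codes_above n k U" for C
  proof -
    have C: "U \<subseteq> C" "C \<subseteq> V"
      using that by (auto simp: codes_above_def linear_codes_eq vec_subspace_def)
    have fin: "finite C" by (rule finite_subset[OF C(2)]) simp
    have "?X C = ?X U + ?X (C - U)" using sum.subset_diff[OF C(1) fin, of "\<lambda>d. w (z - d)"] by simp
    also have "C - U = (V - U) \<inter> C" using C by auto
    finally show ?thesis 
      by (simp add: sum.inter_restrict if_distrib[of "\<lambda>b. b * _"] of_bool_def cong: if_cong)
  qed
  have adj: "codes_above n k (adjoin U d) = {C \<in> codes_above n k U. d \<in> C}" if "d \<in> V" for d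
    using that Suc.prems(1) adjoin_subset_iff unfolding codes_above_def linear_codes_eq by blast
  \<comment> \<open>The codes containing \<open>d\<close> are those above \<open>adjoin U d\<close>,
    to which the induction hypothesis applies with \<open>shift_sum g d\<close>; returning to the
    codes above \<open>U\<close> costs the factor \<open>a\<close>.\<close>
  have outer: "(\<Sum>C\<in>codes_above n k U. ?X C ^ j * of_bool (d \<in> C)) \<le> a * ?N U * ?R (shift_sum g d)"
    if d: "d \<in> V - U" for d
  proof -
    have "(\<Sum>C\<in>codes_above n k U. ?X C ^ j * of_bool (d \<in> C))
        = (\<Sum>C\<in>codes_above n k (adjoin U d). ?X C ^ j)"
      using d by (simp add: adj sum.inter_filter of_bool_def if_distrib cong: if_cong)
    also have "\<dots> \<le> ?N (adjoin U d) * ?R (shift_sum g d)"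
      using d Suc.prems
      by (intro Suc.IH vec_subspace_adjoin shift_sum_nonneg sum_adjoin_le w_nonneg) auto
    also have "\<dots> \<le> a * ?N U * ?R (shift_sum g d)"
      using d Suc.prems \<open>k \<le> n\<close> a unfolding a_def
      by (intro mult_right_mono card_codes_above_adjoin_le[where 'a='a, folded q_eq] sum_nonneg mult_nonneg_nonneg avg_nonneg
          shift_sum_nonneg) auto
    finally show ?thesis .
  qed
  have XU: "0 \<le> ?X U" "?X U \<le> g z" using Suc.prems z w_nonneg by (auto intro: sum_nonneg)
  have "(\<Sum>C\<in>codes_above n k U. ?X C ^ Suc j)
      = (\<Sum>C\<in>codes_above n k U. ?X C ^ j * (?X U + (\<Sum>d\<in>V - U. of_bool (d \<in> C) * w (z - d))))"
    by (intro sum.cong refl) (simp only: power_Suc2 split)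
  also have "\<dots> = ?X U * (\<Sum>C\<in>codes_above n k U. ?X C ^ j)
      + (\<Sum>d\<in>V - U. w (z - d) * (\<Sum>C\<in>codes_above n k U. ?X C ^ j * of_bool (d \<in> C)))"
    by (rule sum_mult_add_swap)
  also have "\<dots> \<le> ?X U * (?N U * ?R g)
      + (\<Sum>d\<in>V - U. w (z - d) * (a * ?N U * ?R (shift_sum g d)))"
    using Suc.prems outer XU by (intro add_mono mult_left_mono sum_mono Suc.IH w_nonneg)
  \<comment> \<open>Including the vectors of \<open>U\<close> adds nonnegative terms and produces
    the recursion of \<open>avg\<close>.\<close>
  also have "\<dots> \<le> ?X U * (?N U * ?R g)
      + (\<Sum>d\<in>V. w (z - d) * (a * ?N U * ?R (shift_sum g d)))"
    using Suc.prems a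
    by (intro add_left_mono sum_mono2 mult_nonneg_nonneg w_nonneg sum_nonneg avg_nonneg
        shift_sum_nonneg) auto
  also have "\<dots> = ?N U * ((\<Sum>t\<le>j. real (j choose t) * (a ^ (j - t) * (?X U * avg (j - t) t g z)))
      + (\<Sum>t\<le>j. real (j choose t) * (a ^ Suc (j - t) * avg (Suc (j - t)) t g z)))"
  proof -
    have "(\<Sum>d\<in>V. w (z - d) * (a * ?N U * ?R (shift_sum g d)))
        = ?N U * (\<Sum>t\<le>j. real (j choose t) * (a ^ Suc (j - t) * avg (Suc (j - t)) t g z))"
      unfolding avg.simps sum_distrib_left by (subst sum.swap) (simp add: mult_ac)
    moreover have "?X U * (?N U * ?R g)
        = ?N U * (\<Sum>t\<le>j. real (j choose t) * (a ^ (j - t) * (?X U * avg (j - t) t g z)))"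
      unfolding sum_distrib_left[of "?N U"] sum_distrib_left[of "?X U"] by (simp add: mult_ac)
    ultimately show ?thesis by (simp add: distrib_left)
  qed
  also have "\<dots> \<le> ?N U * ((\<Sum>t\<le>j. real (j choose t) * (a ^ (j - t) * avg (j - t) (Suc t) g z))
      + (\<Sum>t\<le>j. real (j choose t) * (a ^ Suc (j - t) * avg (Suc (j - t)) t g z)))"
    using Suc.prems a z XU by (intro mult_left_mono add_right_mono sum_mono mult_avg_le) auto
  also have "\<dots> = ?N U * (\<Sum>t\<le>Suc j. real (Suc j choose t) * (a ^ (Suc j - t) * avg (Suc j - t) t g z))"
    using pascal_sum[of j "\<lambda>l t. a ^ l * avg l t g z"] by simp
  finally show ?case .
qed

section \<open>The expected moment over a random code\<close>

text \<open>For a subspace \<open>C\<close> this is the noise mass of the coset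
  \<open>z + C\<close>; divided by \<open>card C\<close> it is the output probability of
  \<open>z\<close>.\<close>

definition coset_mass :: "'a vec set \<Rightarrow> 'a vec \<Rightarrow> real" where
  "coset_mass C z = (\<Sum>d\<in>C. w (z - d))"

lemma coset_mass_nonneg: "coset_mass C z \<ge> 0"
  by (simp add: coset_mass_def sum_nonneg w_nonneg)

lemma coset_mass_translate:
  assumes "vec_subspace n C" "c \<in> C" "z \<in> V"
  shows "coset_mass C (z - c) = coset_mass C z"
  unfolding coset_mass_def
proof (rule sum.reindex_bij_witness[of _ "\<lambda>d. d - c" "\<lambda>d. d + c"])
  note C = vec_subspaceD[OF assms(1)]
  fix d assume d: "d \<in> C"
  have carr: "c \<in> V" "d \<in> V" using C(1) assms d by auto
  then show "d - c + c = d" "d + c - c = d" by (auto intro!: eq_vecI)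
  show "d + c \<in> C" "d - c \<in> C" using C d assms(2) by auto
  show "w (z - (d + c)) = w (z - c - d)"
    using carr assms(3) by (intro arg_cong[of _ _ w] eq_vecI) auto
qed

text \<open>One factor is expanded over the codewords \<open>c\<close>, and \<open>y\<close> is
  translated by \<open>c\<close>; the remaining factors are constant on cosets and do not
  change.\<close>

lemma sum_coset_mass_mult:
  assumes C: "vec_subspace n C"
  shows "(\<Sum>y\<in>V. coset_mass C y * coset_mass C y ^ m)
    = real (card C) * (\<Sum>z\<in>V. w z * coset_mass C z ^ m)"
proof -
  note Cc = vec_subspaceD(1)[OF C]
  have "(\<Sum>y\<in>V. coset_mass C y * coset_mass C y ^ m)
      = (\<Sum>y\<in>V. \<Sum>c\<in>C. w (y - c) * coset_mass C y ^ m)"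
    by (intro sum.cong refl) (simp add: coset_mass_def[of C] sum_distrib_right)
  also have "\<dots> = (\<Sum>c\<in>C. \<Sum>y\<in>V. w (y - c) * coset_mass C y ^ m)" by (rule sum.swap)
  also have "\<dots> = (\<Sum>c\<in>C. \<Sum>y\<in>V. w (y - c) * coset_mass C (y - c) ^ m)"
    using coset_mass_translate[OF C] by (intro sum.cong refl) simp
  also have "\<dots> = (\<Sum>c\<in>C. \<Sum>z\<in>V. w z * coset_mass C z ^ m)"
    using Cc by (intro sum.cong refl sum_carrier_vec_translate[of _ n "\<lambda>z. w z * coset_mass C z ^ m"]) auto
  finally show ?thesis by simp
qed

lemma sum_coset_mass: "vec_subspace n C \<Longrightarrow> (\<Sum>y\<in>V. coset_mass C y) = real (card C)"
  using sum_coset_mass_mult[of C 0] by (simp add: sum_w)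

text \<open>Jensen's inequality, via Bernoulli for \<open>?u\<close>, whose average over the space
  is 1. It yields nonnegativity of the divergence.\<close>

lemma sum_power_coset_mass_ge_1:
  assumes "vec_subspace n C" "card C > 0"
  shows "(\<Sum>y\<in>V. (coset_mass C y / real (card C)) ^ Suc m * (q ^ n) ^ m) \<ge> 1"
proof -
  let ?u = "\<lambda>y. coset_mass C y / real (card C) * q ^ n"
  have q0: "q > 0" using q_gt_1 by simp
  have "real (card V) = q ^ n" by (simp add: card_carrier_vec q_eq)
  then have "(\<Sum>y\<in>V. 1 + real (Suc m) * (?u y - 1)) = q ^ n"
    using sum_coset_mass[OF assms(1)] assms(2)
    by (simp add: sum.distrib sum_subtractf flip: sum_distrib_left sum_distrib_right sum_divide_distrib)
  moreover have "1 + real (Suc m) * (?u y - 1) \<le> ?u y ^ Suc m" for y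
    using Bernoulli_inequality[of "?u y - 1" "Suc m"] coset_mass_nonneg[of C y] q0 by simp
  ultimately have "q ^ n \<le> (\<Sum>y\<in>V. ?u y ^ Suc m)"
    by (metis (no_types, lifting) sum_mono)
  also have "\<dots> = q ^ n * (\<Sum>y\<in>V. (coset_mass C y / real (card C)) ^ Suc m * (q ^ n) ^ m)"
    unfolding sum_distrib_left by (intro sum.cong refl) (simp only: power_mult_distrib power_Suc mult_ac)
  finally show ?thesis using q0 by simp
qed

text \<open>In the application \<open>e\<close> is q^(-\<epsilon> n), and the last hypothesis is the
  rate condition in exponential form.\<close>

lemma expectation_moment_le:
  assumes "k \<le> n" "m \<ge> 1" "e \<le> 1"
    and e: "q ^ n / q ^ k * (\<Sum>x\<in>V. w x ^ Suc m) powr (1 / m) \<le> e"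
  shows "measure_pmf.expectation (pmf_of_set (linear_codes n k))
      (\<lambda>C. \<Sum>y\<in>V. (coset_mass C y / real (card C)) ^ Suc m * (q ^ n) ^ m)
    \<le> 1 + 2 ^ m * q ^ (m * m + m) * e"
proof -
  define a where "a = q ^ k / q ^ n"
  define L where "L = (\<Sum>x\<in>V. w x ^ Suc m)"
  let ?B = "linear_codes n k :: 'a vec set set"
  let ?N = "real (card ?B)"
  let ?A = "\<lambda>t. \<Sum>z\<in>V. w z * avg (m - t) t w z"
  have q0: "q > 0" and q1: "q \<ge> 1" using q_gt_1 by auto
  have a0: "a > 0" using q0 by (simp add: a_def)
  have N0: "?N > 0" using linear_codes_nonempty[OF \<open>k \<le> n\<close>, where 'a='a] by (simp add: card_gt_0_iff)
  have "L > 0" unfolding L_def by (rule sum_power_w_pos)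
  have e0: "e \<ge> 0"
    using order_trans[OF _ e, of 0] q0 by simp
  \<comment> \<open>\<open>code_moment_le\<close> starts from the zero subspace with
    \<open>g = w\<close>; every code lies above it.\<close>
  have zero: "vec_subspace n {0\<^sub>v n :: 'a vec}" by (auto simp: vec_subspace_def)
  have above: "codes_above n k {0\<^sub>v n :: 'a vec} = ?B"
    by (auto simp: codes_above_def linear_codes_eq vec_subspace_def)
  have S: "(\<Sum>y\<in>V. (coset_mass C y / real (card C)) ^ Suc m * (q ^ n) ^ m)
      = (\<Sum>z\<in>V. w z * (1 / a) ^ m * coset_mass C z ^ m)" if "C \<in> ?B" for C
  proof -
    have C: "vec_subspace n C" "real (card C) = q ^ k" using that by (auto simp: linear_codes_eq q_eq)
    have "(\<Sum>y\<in>V. (coset_mass C y / real (card C)) ^ Suc m * (q ^ n) ^ m)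
        = (q ^ n) ^ m / (q ^ k) ^ Suc m * (\<Sum>y\<in>V. coset_mass C y * coset_mass C y ^ m)"
      unfolding sum_distrib_left by (intro sum.cong refl) (simp add: C(2) power_divide)
    also have "\<dots> = (1 / a) ^ m * (\<Sum>z\<in>V. w z * coset_mass C z ^ m)"
      unfolding sum_coset_mass_mult[OF C(1)] C(2) using q0 by (simp add: a_def power_divide)
    finally show ?thesis by (simp add: sum_distrib_left mult_ac)
  qed
  have "(\<Sum>C\<in>?B. \<Sum>y\<in>V. (coset_mass C y / real (card C)) ^ Suc m * (q ^ n) ^ m)
      = (\<Sum>z\<in>V. w z * (1 / a) ^ m * (\<Sum>C\<in>?B. coset_mass C z ^ m))"
    unfolding sum_distrib_left by (subst sum.swap) (intro sum.cong refl S)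
  also have "\<dots> \<le> (\<Sum>z\<in>V. w z * (1 / a) ^ m *
      (?N * (\<Sum>t\<le>m. real (m choose t) * (a ^ (m - t) * avg (m - t) t w z))))"
  proof (intro sum_mono mult_left_mono)
    fix z assume z: "z \<in> V"
    have "(\<Sum>u\<in>{0\<^sub>v n}. w (x - u)) \<le> w x" if "x \<in> V" for x using that by simp
    from code_moment_le[OF \<open>k \<le> n\<close> z zero w_nonneg this, of m]
    show "(\<Sum>C\<in>?B. coset_mass C z ^ m)
        \<le> ?N * (\<Sum>t\<le>m. real (m choose t) * (a ^ (m - t) * avg (m - t) t w z))"
      by (simp add: above coset_mass_def a_def)
  qed (use w_nonneg a0 in simp)
  also have "\<dots> = ?N * (\<Sum>t\<le>m. real (m choose t) * ((1 / a) ^ t * ?A t))"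
  proof -
    have eq: "(1 / a) ^ m * a ^ (m - t) = (1 / a) ^ t" if "t \<le> m" for t
      using that a0 by (simp add: power_divide power_diff)
    have *: "w z * (1 / a) ^ m * (?N * (real (m choose t) * (a ^ (m - t) * avg (m - t) t w z)))
        = ?N * (real (m choose t) * ((1 / a) ^ t * (w z * avg (m - t) t w z)))" if "t \<le> m" for t z
      unfolding eq[OF that, symmetric] by (simp only: mult_ac)
    show ?thesis
      unfolding sum_distrib_left by (subst sum.swap) (intro sum.cong refl, simp add: *)
  qed
  also have "\<dots> \<le> ?N * (1 + 2 ^ m * q ^ (m * m + m) * e)"
  proof (rule mult_left_mono)
    \<comment> \<open>\<open>t = 0\<close> gives the leading 1. For t \<ge> 1 a bounded power of q
      remains, times the t-th power of a quantity at most \<open>e\<close>; and e^t \<le> e because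
      e \<le> 1.\<close>
    have "real (m choose t) * ((1 / a) ^ t * ?A t)
        \<le> of_bool (t = 0) + real (m choose t) * (q ^ (m * m + m) * e)" if t: "t \<le> m" for t
    proof (cases "t = 0")
      case True
      have "?A 0 = 1" using avg_0_right[where g=w] sum_w by simp
      then show ?thesis using True e0 q0 by simp
    next
      case False
      have "?A t \<le> q ^ (t * (m - t)) * (q ^ (m - t) * (L powr (1 / m)) ^ t)"
      proof -
        have "?A t \<le> q ^ (t * (m - t)) * (q ^ (m - t) * (\<Sum>x\<in>V. w x ^ Suc t))"
          by (rule sum_avg_power_le)
        also have "\<dots> \<le> q ^ (t * (m - t)) * (q ^ (m - t) * L powr (t / m))"
          unfolding L_def using q0 t \<open>m \<ge> 1\<close>
          by (intro mult_left_mono sum_power_le_sum_power) auto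
        also have "L powr (t / m) = (L powr (1 / m)) ^ t"
          using \<open>L > 0\<close> by (simp add: powr_powr flip: powr_realpow)
        finally show ?thesis .
      qed
      then have "(1 / a) ^ t * ?A t
          \<le> (1 / a) ^ t * (q ^ (t * (m - t)) * (q ^ (m - t) * (L powr (1 / m)) ^ t))"
        using a0 by (intro mult_left_mono) auto
      also have "\<dots> = q ^ (t * (m - t) + (m - t)) * ((1 / a) * L powr (1 / m)) ^ t"
        by (simp only: power_add power_mult_distrib mult_ac)
      also have "\<dots> \<le> q ^ (m * m + m) * e"
      proof (intro mult_mono)
        show "q ^ (t * (m - t) + (m - t)) \<le> q ^ (m * m + m)"
          using q1 t by (intro power_increasing add_mono mult_le_mono) auto
        have "((1 / a) * L powr (1 / m)) ^ t \<le> e ^ t"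
          using e a0 q0 by (intro power_mono) (auto simp: a_def L_def)
        also have "\<dots> \<le> e ^ 1" using False e0 \<open>e \<le> 1\<close> by (intro power_decreasing) auto
        finally show "((1 / a) * L powr (1 / m)) ^ t \<le> e" by simp
      qed (use q0 a0 in auto)
      finally show ?thesis using False by (simp add: mult_left_mono)
    qed
    then have "(\<Sum>t\<le>m. real (m choose t) * ((1 / a) ^ t * ?A t))
        \<le> (\<Sum>t\<le>m. of_bool (t = 0) + real (m choose t) * (q ^ (m * m + m) * e))"
      by (intro sum_mono) auto
    also have "\<dots> = 1 + (\<Sum>t\<le>m. real (m choose t)) * (q ^ (m * m + m) * e)"
      by (simp add: sum.distrib sum_distrib_right of_bool_def)
    also have "(\<Sum>t\<le>m. real (m choose t)) = 2 ^ m"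
      using choose_row_sum[of m] by (simp flip: of_nat_sum)
    finally show "(\<Sum>t\<le>m. real (m choose t) * ((1 / a) ^ t * ?A t))
        \<le> 1 + 2 ^ m * q ^ (m * m + m) * e" by (simp add: mult_ac)
  qed simp
  finally show ?thesis
    using N0 by (subst integral_pmf_of_set) (auto simp: field_simps)
qed

end

section \<open>The output distribution, and its divergence as a power sum\<close>

lemma noise_pmf:
  fixes W :: "'a::{field,finite} vec pmf"
  assumes "set_pmf W \<subseteq> carrier_vec n" "q = real CARD('a)"
  shows "noise n q (pmf W)"
  using assms by unfold_locales (auto simp: sum_pmf_eq_1)

lemma pmf_indep_sum_uniform:
  fixes W :: "'a::{field,finite} vec pmf"
  assumes W: "set_pmf W \<subseteq> carrier_vec n" and C: "C \<subseteq> carrier_vec n" "C \<noteq> {}"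
    and y: "y \<in> carrier_vec n"
  shows "pmf (indep_sum_pmf (pmf_of_set C) W) y = (\<Sum>c\<in>C. pmf W (y - c)) / card C"
proof -
  have fin: "finite C" by (rule finite_subset[OF C(1)]) simp
  have "indep_sum_pmf (pmf_of_set C) W = bind_pmf (pmf_of_set C) (\<lambda>c. map_pmf (\<lambda>z. c + z) W)"
    by (simp add: indep_sum_pmf_def pair_pmf_def map_bind_pmf map_pmf_def bind_assoc_pmf bind_return_pmf)
  moreover have "pmf (map_pmf (\<lambda>z. c + z) W) y = pmf W (y - c)" if "c \<in> C" for c
  proof -
    have "c \<in> carrier_vec n" using C that by auto
    then have "c + z = y \<longleftrightarrow> z = y - c" if "z \<in> carrier_vec n" for z
      using that y by (auto intro!: eq_vecI)
    \<comment> \<open>The equivalence is shown for \<open>z\<close> of length n, so the two events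
      are compared on the support of \<open>W\<close>.\<close>
    then have "(\<lambda>z. c + z) -` {y} \<inter> set_pmf W = {y - c} \<inter> set_pmf W" using W by auto
    then have "measure W ((\<lambda>z. c + z) -` {y}) = measure W {y - c}"
      by (metis measure_Int_set_pmf)
    then show ?thesis by (simp add: pmf_map measure_pmf_single)
  qed
  ultimately show ?thesis using fin C by (simp add: pmf_bind_pmf_of_set)
qed

lemma renyi_sum_smoothing:
  fixes W :: "'a::{field,finite} vec pmf"
  assumes W: "set_pmf W \<subseteq> carrier_vec n" and q: "q = real CARD('a)"
    and C: "C \<subseteq> carrier_vec n" "C \<noteq> {}"
  shows "smoothing_divergence (real (Suc m)) n W C
    = 1 / m * log q (\<Sum>y\<in>carrier_vec n.
        ((\<Sum>d\<in>C. pmf W (y - d)) / real (card C)) ^ Suc m * (q ^ n) ^ m)"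
proof -
  have q1: "q > 1"
    using noise.q_gt_1[OF noise_pmf[OF W q]] .
  have ne: "(carrier_vec n :: 'a vec set) \<noteq> {}" using C by auto
  have "pmf (indep_sum_pmf (pmf_of_set C) W) y powr real (Suc m)
        * pmf (pmf_of_set (carrier_vec n)) y powr (1 - real (Suc m))
      = ((\<Sum>d\<in>C. pmf W (y - d)) / real (card C)) ^ Suc m * (q ^ n) ^ m"
    if "y \<in> carrier_vec n" for y :: "'a vec"
  proof -
    have "pmf (pmf_of_set (carrier_vec n)) y = 1 / q ^ n"
      using that ne by (simp add: card_carrier_vec q)
    moreover have "(1 / q ^ n) powr (1 - real (Suc m)) = (q ^ n) ^ m"
      using q1 by (simp add: powr_minus powr_divide powr_realpow)
    \<comment> \<open>x = 0 is covered because the exponent is nonzero.\<close>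
    moreover have "x powr real (Suc m) = x ^ Suc m" if "x \<ge> 0" for x :: real
      using that by (rule powr_realpow') simp
    ultimately show ?thesis
      using pmf_indep_sum_uniform[OF W C that] pmf_nonneg[of "indep_sum_pmf (pmf_of_set C) W" y]
      by metis
  qed
  then show ?thesis
    unfolding smoothing_divergence_def renyi_divergence_def q[symmetric] by simp
qed

section \<open>Smoothing\<close>

lemma expectation_uniform_mono:
  fixes f g :: "'b \<Rightarrow> real"
  assumes "finite B" "B \<noteq> {}" "\<And>x. x \<in> B \<Longrightarrow> f x \<le> g x"
  shows "measure_pmf.expectation (pmf_of_set B) f \<le> measure_pmf.expectation (pmf_of_set B) g"
  using assms by (simp add: integral_pmf_of_set divide_right_mono sum_mono)

text \<open>Everything for one block length, with constants in \<open>m\<close> and \<open>q\<close>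
  only, so that the limit can be taken afterwards.\<close>

lemma smoothing_bounds:
  fixes W :: "'a::{field,finite} vec pmf" and D :: "'a vec set \<Rightarrow> real" and m n k :: nat and q \<epsilon> :: real
  defines "E \<equiv> \<lambda>f. measure_pmf.expectation (pmf_of_set (linear_codes n k)) f :: real"
    and "D \<equiv> smoothing_divergence (real (Suc m)) n W"
  assumes W: "set_pmf W \<subseteq> carrier_vec n" and q: "q = real CARD('a)" and "k \<le> n" "m \<ge> 1"
    and "\<epsilon> > 0" "n \<ge> 1"
    and rate: "real k / real n \<ge> 1 - renyi_entropy q (real (Suc m)) (carrier_vec n) W / real n + \<epsilon>"
  shows "E (\<lambda>C. q powr (m * D C)) \<le> 1 + 2 ^ m * q ^ (m * m + m) * q powr (- \<epsilon> * n)"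
    and "0 \<le> E D" "E D \<le> 2 ^ m * q ^ (m * m + m) * q powr (- \<epsilon> * n) / (m * ln q)"
proof -
  interpret noise n q "pmf W" by (rule noise_pmf[OF W q])
  let ?B = "linear_codes n k :: 'a vec set set"
  let ?L = "\<Sum>x\<in>V. pmf W x ^ Suc m"
  let ?e = "q powr (- \<epsilon> * n)" and ?K = "2 ^ m * q ^ (m * m + m) :: real"
  define S where "S C = (\<Sum>y\<in>V. (coset_mass C y / real (card C)) ^ Suc m * (q ^ n) ^ m)" for C
  have B: "?B \<noteq> {}" using linear_codes_nonempty[OF \<open>k \<le> n\<close>] .
  have codes: "vec_subspace n C" "card C > 0" "D C = 1 / m * log q (S C)" if "C \<in> ?B" for C
  proof -
    show C: "vec_subspace n C" "card C > 0" using that by (auto simp: linear_codes_eq)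
    show "D C = 1 / m * log q (S C)"
      unfolding D_def S_def coset_mass_def
      using vec_subspaceD(1,2)[OF C(1)] by (intro renyi_sum_smoothing W q) auto
  qed
  have S1: "S C \<ge> 1" if "C \<in> ?B" for C
    unfolding S_def using codes[OF that] by (intro sum_power_coset_mass_ge_1)
  have "?L > 0" by (rule sum_power_w_pos)
  have "renyi_entropy q (real (Suc m)) V W = - (1 / m) * log q ?L"
  proof -
    have "(\<Sum>x\<in>V. pmf W x powr real (Suc m)) = ?L"
      by (intro sum.cong refl powr_realpow') auto
    then show ?thesis by (simp add: renyi_entropy_def)
  qed
  moreover have "real k \<ge> real n - renyi_entropy q (real (Suc m)) V W + \<epsilon> * n"
    using mult_right_mono[OF rate, of "real n"] \<open>n \<ge> 1\<close>
    by (simp add: distrib_right left_diff_distrib)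
  \<comment> \<open>The entropy is -(1/m) log \<open>?L\<close>, so this is the rate condition;
    exponentiating it gives the hypothesis of \<open>expectation_moment_le\<close>.\<close>
  ultimately have "real n - real k + (1 / m) * log q ?L \<le> - \<epsilon> * n" by simp
  then have "q powr (real n - real k + (1 / m) * log q ?L) \<le> ?e"
    using q_gt_1 by (intro powr_mono) auto
  also have "q powr (real n - real k + (1 / m) * log q ?L) = q ^ n / q ^ k * ?L powr (1 / m)"
  proof -
    have "q powr ((1 / m) * log q ?L) = ?L powr (1 / m)"
      using q_gt_1 \<open>?L > 0\<close> powr_powr[of q "log q ?L" "1 / m"] by (simp add: mult.commute)
    then show ?thesis using q_gt_1 by (simp add: powr_add powr_diff powr_realpow)
  qed
  finally have "q ^ n / q ^ k * ?L powr (1 / m) \<le> ?e" .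
  moreover have "?e \<le> 1" using q_gt_1 \<open>\<epsilon> > 0\<close> powr_mono[of "- \<epsilon> * n" 0 q] by simp
  ultimately have ES: "E S \<le> 1 + ?K * ?e"
    unfolding E_def S_def using \<open>k \<le> n\<close> \<open>m \<ge> 1\<close> by (intro expectation_moment_le) auto
  have "q powr (m * D C) = S C" if "C \<in> ?B" for C
    using codes(3)[OF that] S1[OF that] q_gt_1 \<open>m \<ge> 1\<close> by simp
  then have "E (\<lambda>C. q powr (m * D C)) \<le> E S"
    unfolding E_def using B by (intro expectation_uniform_mono) auto
  then show "E (\<lambda>C. q powr (m * D C)) \<le> 1 + ?K * ?e" using ES by linarith
  have lnq: "ln q > 0" using q_gt_1 by simp
  have "0 \<le> D C" if "C \<in> ?B" for C
  proof -
    have "S C > 0" using S1[OF that] by linarith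
    then have "log q (S C) \<ge> 0" using S1[OF that] q_gt_1 by simp
    then show ?thesis using codes(3)[OF that] by simp
  qed
  then have "E (\<lambda>_. 0) \<le> E D"
    unfolding E_def using B by (intro expectation_uniform_mono) auto
  then show "0 \<le> E D" by (simp add: E_def)
  have "E D \<le> E (\<lambda>C. (S C - 1) / (m * ln q))"
    unfolding E_def
  proof (rule expectation_uniform_mono)
    fix C assume C: "C \<in> ?B"
    \<comment> \<open>Bounding the logarithm linearly transfers the estimate of \<open>E S\<close>
      to \<open>E D\<close>.\<close>
    have "ln (S C) \<le> S C - 1" using S1[OF C] by (intro ln_le_minus_one) simp
    then show "D C \<le> (S C - 1) / (m * ln q)"
      using codes(3)[OF C] lnq by (simp add: log_def divide_right_mono)
  qed (use B in auto)
  also have "\<dots> = (E S - 1) / (m * ln q)"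
    unfolding E_def using B
    by (simp add: integral_pmf_of_set sum_subtractf diff_divide_distrib flip: sum_divide_distrib)
  also have "\<dots> \<le> ?K * ?e / (m * ln q)"
    using ES lnq by (intro divide_right_mono) auto
  finally show "E D \<le> ?K * ?e / (m * ln q)" .
qed

theorem theorem2:
  fixes \<alpha> :: nat and \<epsilon> q :: real
    and W :: "nat \<Rightarrow> 'a::{field,finite} vec pmf"
    and k :: "nat \<Rightarrow> nat"
  assumes "q = real CARD('a)"
    and "\<alpha> \<ge> 2"
    and "\<epsilon> > 0"
    and "\<And>n. n \<ge> 1 \<Longrightarrow> set_pmf (W n) \<subseteq> carrier_vec n"
    and "\<And>n. n \<ge> 1 \<Longrightarrow> 1 \<le> k n \<and> k n \<le> n"
    and "\<And>n. n \<ge> 1 \<Longrightarrow>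
           real (k n) / real n \<ge> 1 - renyi_entropy q \<alpha> (carrier_vec n) (W n) / real n + \<epsilon>"
  shows "(\<lambda>n. measure_pmf.expectation (pmf_of_set (linear_codes n (k n)))
                (\<lambda>C. smoothing_divergence \<alpha> n (W n) C)) \<longlonglongrightarrow> 0
       \<and> (\<exists>g \<in> O(\<lambda>n. q powr (- \<epsilon> * real n)).
            \<forall>\<^sub>F n in sequentially.
              measure_pmf.expectation (pmf_of_set (linear_codes n (k n)))
                (\<lambda>C. q powr ((real \<alpha> - 1) * smoothing_divergence \<alpha> n (W n) C)) \<le> 1 + g n)"
proof -
  define m where "m = \<alpha> - 1"
  have m: "m \<ge> 1" "\<alpha> = Suc m" "real \<alpha> - 1 = real m" using assms(2) by (auto simp: m_def)
  have q1: "q > 1" using noise.q_gt_1[OF noise_pmf[OF assms(4) assms(1), of 1]] by simp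
  let ?K = "2 ^ m * q ^ (m * m + m) :: real"
  note bounds = smoothing_bounds[OF assms(4) assms(1) _ m(1) assms(3) _ assms(6)[unfolded m(2)],
      folded m(2)]
  have "(\<lambda>n. (q powr (- \<epsilon>)) ^ n) \<longlonglongrightarrow> 0"
    using q1 assms(3) powr_less_mono[of "- \<epsilon>" 0 q] by (intro LIMSEQ_power_zero) simp
  moreover have "(q powr (- \<epsilon>)) ^ n = q powr (- \<epsilon> * n)" for n
    using q1 by (simp add: powr_powr flip: powr_realpow)
  ultimately have "(\<lambda>n. q powr (- \<epsilon> * real n)) \<longlonglongrightarrow> 0" by simp
  from tendsto_mult_right_zero[OF this, of "?K / (m * ln q)"]
  have lim: "(\<lambda>n. ?K * q powr (- \<epsilon> * real n) / (m * ln q)) \<longlonglongrightarrow> 0" by (simp add: field_simps)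
  have zero: "(\<lambda>n. measure_pmf.expectation (pmf_of_set (linear_codes n (k n)))
      (\<lambda>C. smoothing_divergence \<alpha> n (W n) C)) \<longlonglongrightarrow> 0"
  proof (rule tendsto_sandwich[OF _ _ tendsto_const lim])
    show "\<forall>\<^sub>F n in sequentially. 0 \<le> measure_pmf.expectation (pmf_of_set (linear_codes n (k n)))
        (\<lambda>C. smoothing_divergence \<alpha> n (W n) C)"
      using eventually_ge_at_top[of 1] by eventually_elim (use bounds(2) assms(5) in blast)
    show "\<forall>\<^sub>F n in sequentially. measure_pmf.expectation (pmf_of_set (linear_codes n (k n)))
        (\<lambda>C. smoothing_divergence \<alpha> n (W n) C) \<le> ?K * q powr (- \<epsilon> * real n) / (m * ln q)"
      using eventually_ge_at_top[of 1] by eventually_elim (use bounds(3) assms(5) in blast)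
  qed
  \<comment> \<open>The witness for \<open>g\<close>; its constant \<open>?K\<close> depends only on
    \<alpha> and q.\<close>
  have big_o: "(\<lambda>n. ?K * q powr (- \<epsilon> * real n)) \<in> O(\<lambda>n. q powr (- \<epsilon> * real n))" by simp
  have "\<forall>\<^sub>F n in sequentially. measure_pmf.expectation (pmf_of_set (linear_codes n (k n)))
      (\<lambda>C. q powr ((real \<alpha> - 1) * smoothing_divergence \<alpha> n (W n) C))
      \<le> 1 + ?K * q powr (- \<epsilon> * real n)"
    unfolding m(3)
    using eventually_ge_at_top[of 1] by eventually_elim (use bounds(1) assms(5) in blast)
  then show ?thesis by (intro conjI zero bexI[OF _ big_o])
qed

end
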